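(* Let $S,T\in M_n(\mathbb{C})$. If $S$ and $T$ are unitarily similar (i.e. $S=V^{*}TV$ for some unitary $V\in M_n(\mathbb{C})$), then $\mathfrak{u}_S\cong\mathfrak{u}_T$ as Lie algebras.
   Context: For $S\in M_n(\mathbb{C})$, $\mathfrak{u}_S=\{X\in M_n(\mathbb{C}) : SX^{*}=-XS\}$, where $X^{*}$ is the conjugate transpose. It is regarded as a real Lie algebra with the bracket $[A,B]=AB-BA$. *)

theory Defs
  imports "HOL-Analysis.Analysis"
begin

definition conj_transpose :: "complex^'n^'m \<Rightarrow> complex^'m^'n" where
  "conj_transpose X = (\<chi> i j. cnj (X $ j $ i))"

definition unitary :: "complex^'n^'n \<Rightarrow> bool" where
  "unitary V \<longleftrightarrow> conj_transpose V ** V = mat 1 \<and> V ** conj_transpose V = mat 1"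

definition unitarily_similar :: "complex^'n^'n \<Rightarrow> complex^'n^'n \<Rightarrow> bool" where
  "unitarily_similar S T \<longleftrightarrow> (\<exists>V. unitary V \<and> S = conj_transpose V ** T ** V)"

text \<open>A real Lie algebra is carried by a real subspace \<open>L\<close> of an ambient real vector space;
  the bracket is only constrained on \<open>L\<close>.\<close>

locale real_lie_algebra =
  fixes L :: "'a::real_vector set" and br :: "'a \<Rightarrow> 'a \<Rightarrow> 'a"
  assumes subspace: "subspace L"
    and closed: "\<lbrakk>x \<in> L; y \<in> L\<rbrakk> \<Longrightarrow> br x y \<in> L"
    and add_left: "\<lbrakk>x \<in> L; y \<in> L; z \<in> L\<rbrakk> \<Longrightarrow> br (x + y) z = br x z + br y z"
    and add_right: "\<lbrakk>x \<in> L; y \<in> L; z \<in> L\<rbrakk> \<Longrightarrow> br x (y + z) = br x y + br x z"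
    and scale_left: "\<lbrakk>x \<in> L; y \<in> L\<rbrakk> \<Longrightarrow> br (c *\<^sub>R x) y = c *\<^sub>R br x y"
    and scale_right: "\<lbrakk>x \<in> L; y \<in> L\<rbrakk> \<Longrightarrow> br x (c *\<^sub>R y) = c *\<^sub>R br x y"
    and alternating: "x \<in> L \<Longrightarrow> br x x = 0"
    and jacobi: "\<lbrakk>x \<in> L; y \<in> L; z \<in> L\<rbrakk> \<Longrightarrow>
      br x (br y z) + br y (br z x) + br z (br x y) = 0"

definition lie_isomorphism ::
    "'a::real_vector set \<Rightarrow> ('a \<Rightarrow> 'a \<Rightarrow> 'a) \<Rightarrow> 'b::real_vector set \<Rightarrow> ('b \<Rightarrow> 'b \<Rightarrow> 'b) \<Rightarrow> ('a \<Rightarrow> 'b) \<Rightarrow> bool"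
  where
  "lie_isomorphism L br M br' f \<longleftrightarrow>
     bij_betw f L M \<and>
     (\<forall>x\<in>L. \<forall>y\<in>L. f (x + y) = f x + f y) \<and>
     (\<forall>c. \<forall>x\<in>L. f (c *\<^sub>R x) = c *\<^sub>R f x) \<and>
     (\<forall>x\<in>L. \<forall>y\<in>L. f (br x y) = br' (f x) (f y))"

definition lie_isomorphic ::
    "'a::real_vector set \<Rightarrow> ('a \<Rightarrow> 'a \<Rightarrow> 'a) \<Rightarrow> 'b::real_vector set \<Rightarrow> ('b \<Rightarrow> 'b \<Rightarrow> 'b) \<Rightarrow> bool"
  where
  "lie_isomorphic L br M br' \<longleftrightarrow>
     real_lie_algebra L br \<and> real_lie_algebra M br' \<and> (\<exists>f. lie_isomorphism L br M br' f)"

definition commutator :: "complex^'n^'n \<Rightarrow> complex^'n^'n \<Rightarrow> complex^'n^'n" where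
  "commutator A B = A ** B - B ** A"

definition u_alg :: "complex^'n^'n \<Rightarrow> (complex^'n^'n) set" where
  "u_alg S = {X. S ** conj_transpose X = - (X ** S)}"

lemma conj_transpose_simps:
  fixes X Y :: "complex^'n^'n"
  shows "conj_transpose 0 = (0 :: complex^'n^'n)"
    and "conj_transpose (X + Y) = conj_transpose X + conj_transpose Y"
    and "conj_transpose (X - Y) = conj_transpose X - conj_transpose Y"
    and "conj_transpose (c *\<^sub>R X) = c *\<^sub>R conj_transpose X"
    and "conj_transpose (X ** Y) = conj_transpose Y ** conj_transpose X"
  by (simp_all add: conj_transpose_def vec_eq_iff matrix_matrix_mult_def mult.commute)

lemma matrix_mult_simps:
  fixes A B C :: "complex^'n^'n"
  shows "A ** (B - C) = A ** B - A ** C" and "(A - B) ** C = A ** C - B ** C"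
    and "A ** (B + C) = A ** B + A ** C" and "(A + B) ** C = A ** C + B ** C"
    and "A ** (- B) = - (A ** B)" and "(- A) ** B = - (A ** B)"
    and "A ** (c *\<^sub>R B) = c *\<^sub>R (A ** B)" and "(c *\<^sub>R A) ** B = c *\<^sub>R (A ** B)"
  by (simp_all add: matrix_matrix_mult_def vec_eq_iff algebra_simps sum_subtractf sum.distrib sum_negf
      scaleR_sum_right)

lemma real_lie_algebra_u_alg:
  fixes S :: "complex^'n^'n"
  shows "real_lie_algebra (u_alg S) commutator"
proof
  show "subspace (u_alg S)"
    by (auto simp: subspace_def u_alg_def conj_transpose_simps matrix_mult_simps)
next
  fix X Y :: "complex^'n^'n"
  assume "X \<in> u_alg S" "Y \<in> u_alg S"
  then have X: "S ** conj_transpose X = - (X ** S)" and Y: "S ** conj_transpose Y = - (Y ** S)"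
    by (simp_all add: u_alg_def)
  have *: "S ** (conj_transpose A ** conj_transpose B) = A ** B ** S"
    if "S ** conj_transpose A = - (A ** S)" "S ** conj_transpose B = - (B ** S)"
    for A B :: "complex^'n^'n"
  proof -
    have "S ** (conj_transpose A ** conj_transpose B) = - (A ** S) ** conj_transpose B"
      using that(1) by (simp add: matrix_mul_assoc)
    also have "\<dots> = - (A ** (S ** conj_transpose B))"
      by (simp add: matrix_mult_simps matrix_mul_assoc)
    also have "\<dots> = A ** B ** S"
      using that(2) by (simp add: matrix_mult_simps matrix_mul_assoc)
    finally show ?thesis .
  qed
  show "commutator X Y \<in> u_alg S"
    using *[OF X Y] *[OF Y X]
    by (simp add: u_alg_def commutator_def conj_transpose_simps matrix_mult_simps)
qed (simp_all add: commutator_def matrix_mult_simps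
    matrix_mul_assoc algebra_simps)

end

theory Submission
  imports Defs
begin

text \<open>The isomorphism is conjugation by the unitary matrix, with inverse conjugation by its
  adjoint: since the adjoint is the inverse, \<open>X \<mapsto> V ** X ** conj_transpose V\<close> respects both
  products and adjoints, so it carries the equation defining \<open>u_alg S\<close> to the one
  defining \<open>u_alg (V ** S ** conj_transpose V)\<close>.\<close>

lemma conj_transpose_conj_transpose [simp]: "conj_transpose (conj_transpose X) = X"
  by (simp add: conj_transpose_def vec_eq_iff)

lemma unitary_conj_transpose: "unitary (conj_transpose V) \<longleftrightarrow> unitary V"
  by (auto simp: unitary_def)

definition unitary_conj :: "complex^'n^'n \<Rightarrow> complex^'n^'n \<Rightarrow> complex^'n^'n" where
  "unitary_conj V X = V ** X ** conj_transpose V"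

text \<open>The inner factors \<open>conj_transpose V ** V\<close> between \<open>X\<close> and
  \<open>Y\<close> cancel by unitarity.\<close>

lemma unitary_conj_mult:
  assumes "unitary V"
  shows "unitary_conj V (X ** Y) = unitary_conj V X ** unitary_conj V Y"
proof -
  have "unitary_conj V X ** unitary_conj V Y
      = V ** X ** (conj_transpose V ** V) ** Y ** conj_transpose V"
    by (simp only: unitary_conj_def matrix_mul_assoc)
  with assms show ?thesis
    by (simp add: unitary_conj_def unitary_def matrix_mul_assoc)
qed

lemma unitary_conj_linear:
  shows unitary_conj_add: "unitary_conj V (X + Y) = unitary_conj V X + unitary_conj V Y"
    and unitary_conj_diff: "unitary_conj V (X - Y) = unitary_conj V X - unitary_conj V Y"
    and unitary_conj_minus: "unitary_conj V (- X) = - unitary_conj V X"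
    and unitary_conj_scaleR: "unitary_conj V (c *\<^sub>R X) = c *\<^sub>R unitary_conj V X"
  by (simp_all add: unitary_conj_def matrix_mult_simps)

lemma conj_transpose_unitary_conj:
  "conj_transpose (unitary_conj V X) = unitary_conj V (conj_transpose X)"
  by (simp add: unitary_conj_def conj_transpose_simps matrix_mul_assoc)

lemma unitary_conj_inverse:
  assumes "unitary V"
  shows "unitary_conj (conj_transpose V) (unitary_conj V X) = X"
proof -
  have "unitary_conj (conj_transpose V) (unitary_conj V X)
      = (conj_transpose V ** V) ** X ** (conj_transpose V ** V)"
    by (simp only: unitary_conj_def conj_transpose_conj_transpose matrix_mul_assoc)
  with assms show ?thesis
    by (simp add: unitary_def)
qed

text \<open>Conjugation is applied to both sides of the equation for \<open>X\<close>; the flipped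
  product rule gathers each side into a single conjugate, so that this equation can be used as a
  rewrite.\<close>

lemma unitary_conj_in_u_alg:
  assumes "unitary V" and "X \<in> u_alg S"
  shows "unitary_conj V X \<in> u_alg (unitary_conj V S)"
  using assms
  by (simp add: u_alg_def conj_transpose_unitary_conj unitary_conj_minus
      flip: unitary_conj_mult)

lemma lie_isomorphism_unitary_conj:
  assumes V: "unitary V"
  shows "lie_isomorphism (u_alg S) commutator (u_alg (unitary_conj V S)) commutator
    (unitary_conj V)"
proof -
  let ?W = "conj_transpose V"
  have W: "unitary ?W"
    using V by (simp add: unitary_conj_transpose)
  have "bij_betw (unitary_conj V) (u_alg S) (u_alg (unitary_conj V S))"
  proof (rule bij_betw_byWitness[where f' = "unitary_conj ?W"])
    show "\<forall>X\<in>u_alg S. unitary_conj ?W (unitary_conj V X) = X"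
      using unitary_conj_inverse[OF V] by blast
    \<comment> \<open>The inverse law for \<open>?W\<close>, whose own adjoint is
      \<open>V\<close>.\<close>
    show "\<forall>X\<in>u_alg (unitary_conj V S). unitary_conj V (unitary_conj ?W X) = X"
      using unitary_conj_inverse[OF W] by simp
    show "unitary_conj V ` u_alg S \<subseteq> u_alg (unitary_conj V S)"
      using unitary_conj_in_u_alg[OF V] by blast
    \<comment> \<open>Conjugation by \<open>?W\<close> lands in
      \<open>u_alg (unitary_conj ?W (unitary_conj V S))\<close>, and the inverse law reduces the
      index to \<open>S\<close>.\<close>
    show "unitary_conj ?W ` u_alg (unitary_conj V S) \<subseteq> u_alg S"
      using unitary_conj_in_u_alg[OF W] unitary_conj_inverse[OF V] by fastforce
  qed
  then show ?thesis
    by (simp add: lie_isomorphism_def commutator_def unitary_conj_linear unitary_conj_mult[OF V])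
qed

theorem proposition1:
  fixes S T :: "complex^'n^'n"
  assumes "unitarily_similar S T"
  shows "lie_isomorphic (u_alg S) commutator (u_alg T) commutator"
proof -
  obtain V where V: "unitary V" and S: "S = conj_transpose V ** T ** V"
    using assms by (auto simp: unitarily_similar_def)
  have "unitary (conj_transpose V)"
    using V by (simp add: unitary_conj_transpose)
  moreover have "S = unitary_conj (conj_transpose V) T"
    using S by (simp add: unitary_conj_def)
  \<comment> \<open>Solving for \<open>T\<close> puts the target in the form
    \<open>u_alg (unitary_conj V S)\<close> of the isomorphism above; the inverse law is used at
    \<open>conj_transpose V\<close>.\<close>
  ultimately have "T = unitary_conj V S"
    using unitary_conj_inverse by fastforce
  with lie_isomorphism_unitary_conj[OF V, of S] show ?thesis
    by (auto simp: lie_isomorphic_def real_lie_algebra_u_alg)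
qed

end
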